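(* Let $n\ge N$ be positive integers. Assume that one of the following holds: (1) $N=2$ and $n$ is not a prime number; (2) $N=4$ and $n$ cannot be written as a sum of two primes. Then $\ell(n,N)=0$.
   Context: For $2\le N\le n$, $\ell(n,N)$ is the number of compositions $(\lambda_1,\dots,\lambda_N)\in\mathbb Z_{>0}^N$ with $\lambda_1+\dots+\lambda_N=n$ such that $\lambda_i+\lambda_{i+1}$ is a prime number for all $i=1,\dots,N-1$ (equivalently, the number of "prime" partial flag varieties $F_{\boldsymbol\lambda}$ of $N$-step flags in $\mathbb C^n$). In a sum of two primes, the two primes may coincide. *)

theory Defs
  imports "HOL-Computational_Algebra.Primes"
begin

(* Lists are indexed from 0, so the index i below corresponds to i + 1 in the usual
   numbering lambda_1, ..., lambda_N. *)
definition prime_compositions :: "nat \<Rightarrow> nat \<Rightarrow> nat list set" where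
  "prime_compositions n N =
     {xs. length xs = N \<and> (\<forall>x\<in>set xs. x > 0) \<and> sum_list xs = n \<and>
          (\<forall>i. i + 1 < N \<longrightarrow> prime (xs ! i + xs ! (i + 1)))}"

definition ell :: "nat \<Rightarrow> nat \<Rightarrow> nat" where
  "ell n N = card (prime_compositions n N)"

(* Since card is 0 on infinite sets, finiteness is needed for ell to be a genuine count. *)
lemma finite_prime_compositions: "finite (prime_compositions n N)"
proof (rule finite_subset)
  show "prime_compositions n N \<subseteq> {xs. set xs \<subseteq> {..n} \<and> length xs = N}"
    by (auto simp: prime_compositions_def intro: member_le_sum_list)
  show "finite {xs. set xs \<subseteq> {..n} \<and> length xs = N}"
    by (rule finite_lists_length_eq) simp
qed

end

theory Submission
  imports Defs
begin

text \<open>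
  Pairing neighbours, \<open>n = (\<lambda>\<^sub>1 + \<lambda>\<^sub>2) + (\<lambda>\<^sub>3 + \<lambda>\<^sub>4) + \<dots>\<close>, turns a composition of even length \<open>N\<close>
  whose neighbouring sums are prime into a way of writing \<open>n\<close> as a sum of \<open>N / 2\<close> primes. So a
  single composition of length 2 makes \<open>n\<close> prime, and one of length 4 makes it a sum of two primes.
\<close>

lemma prime_composition_length_2:
  assumes "xs \<in> prime_compositions n 2"
  shows "prime n"
proof -
  from assms obtain a b where "xs = [a, b]"
    by (auto simp: prime_compositions_def length_Suc_conv numeral_eq_Suc)
  with assms show ?thesis
    by (auto simp: prime_compositions_def)
qed

lemma prime_composition_length_4:
  assumes "xs \<in> prime_compositions n 4"
  shows "\<exists>p q. prime p \<and> prime q \<and> n = p + q"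
proof -
  from assms obtain a b c d where xs: "xs = [a, b, c, d]"
    by (auto simp: prime_compositions_def length_Suc_conv numeral_eq_Suc)
  have neighbours: "prime (xs ! i + xs ! (i + 1))" if "i + 1 < 4" for i
    using assms that by (simp add: prime_compositions_def)
  have "prime (a + b)" "prime (c + d)"
    using neighbours[of 0] neighbours[of 2] xs by simp_all
  moreover have "n = (a + b) + (c + d)"
    using assms xs by (simp add: prime_compositions_def)
  ultimately show ?thesis
    by blast
qed

theorem theorem6p6:
  fixes n N :: nat
  assumes "0 < N" and "N \<le> n"
    and "(N = 2 \<and> \<not> prime n) \<or>
         (N = 4 \<and> \<not> (\<exists>p q :: nat. prime p \<and> prime q \<and> n = p + q))"
  shows "ell n N = 0"
proof -
  have "prime_compositions n N = {}"
    using assms(3) prime_composition_length_2 prime_composition_length_4 by blast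
  then show ?thesis
    by (simp add: ell_def)
qed

end
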